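(* Let $n\ge 1$ and $k\ge 1$ be integers, let $w_1,\dots,w_n$ be nonnegative integers, and define $w(A)=\sum_{i\in A}w_i$ for $A\subseteq[n]=\{1,\dots,n\}$. Then the set function $A\mapsto\min(w(A),k)$ on $2^{[n]}$ is entropic up to a constant factor.
   Context: A set function $f:2^{[n]}\to\mathbb{R}_{\ge 0}$ is called entropic if there exist jointly distributed (discrete) random variables $X_1,\dots,X_n$ such that $f(A)=H(X_A)$ for all $A\subseteq[n]$, where $X_A=(X_i)_{i\in A}$ and $H$ denotes (joint) Shannon entropy, with $H(X_\emptyset)=0$. A set function $f$ is entropic up to a constant factor if there is a constant $c>0$ such that $c\cdot f$ is entropic. *)

theory Defs
  imports "HOL-Probability.Probability"
begin

definition joint_var :: "(nat \<Rightarrow> 'a \<Rightarrow> 'b) \<Rightarrow> nat set \<Rightarrow> 'a \<Rightarrow> nat \<Rightarrow> 'b" where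
  "joint_var X A = (\<lambda>\<omega>. \<lambda>i\<in>A. X i \<omega>)"

definition joint_alphabet :: "nat set \<Rightarrow> (nat \<Rightarrow> 'b) measure" where
  "joint_alphabet A = count_space (A \<rightarrow>\<^sub>E UNIV)"

(* The library's entropy is a Bochner integral and hence 0 when -sum p log p diverges;
   finite_entropy excludes this case, so f A really is the Shannon entropy (in bits). *)
definition has_entropy_function ::
  "'a measure \<Rightarrow> (nat \<Rightarrow> 'a \<Rightarrow> nat) \<Rightarrow> nat \<Rightarrow> (nat set \<Rightarrow> real) \<Rightarrow> bool" where
  "has_entropy_function M X n f \<longleftrightarrow>
     information_space M 2 \<and>
     (\<forall>i\<in>{1..n}. X i \<in> measurable M (count_space UNIV)) \<and>
     (\<forall>A. A \<subseteq> {1..n} \<longrightarrow>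
        (\<exists>p. information_space.finite_entropy M 2 (joint_alphabet A) (joint_var X A) p) \<and>
        f A = prob_space.entropy M 2 (joint_alphabet A) (joint_var X A))"

(* Discrete random variables take countably many values, so they are coded as nat-valued.
   Fixing the type of the sample space to nat is no restriction either: see
   has_entropy_function_imp_entropic below. *)
definition entropic :: "nat \<Rightarrow> (nat set \<Rightarrow> real) \<Rightarrow> bool" where
  "entropic n f \<longleftrightarrow>
     (\<exists>(M :: nat measure) (X :: nat \<Rightarrow> nat \<Rightarrow> nat). has_entropy_function M X n f)"

definition entropic_up_to_constant_factor :: "nat \<Rightarrow> (nat set \<Rightarrow> real) \<Rightarrow> bool" where
  "entropic_up_to_constant_factor n f \<longleftrightarrow> (\<exists>c>0. entropic n (\<lambda>A. c * f A))"

lemma has_entropy_function_imp_entropic: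
  fixes M :: "'a measure"
  assumes "has_entropy_function M X n f"
  shows "entropic n f"
proof -
  define g where "g = (\<lambda>\<omega>. to_nat (map (\<lambda>i. X i \<omega>) [1..<Suc n]))"
  define Y where "Y = (\<lambda>i m. (from_nat m :: nat list) ! (i - 1))"
  define N where "N = distr M (count_space UNIV) g"
  have inf: "information_space M 2"
    and X: "\<And>i. i \<in> {1..n} \<Longrightarrow> X i \<in> measurable M (count_space UNIV)"
    and H: "\<And>A. A \<subseteq> {1..n} \<Longrightarrow>
        (\<exists>p. information_space.finite_entropy M 2 (joint_alphabet A) (joint_var X A) p) \<and>
        f A = prob_space.entropy M 2 (joint_alphabet A) (joint_var X A)"
    using assms unfolding has_entropy_function_def by blast+
  interpret M: information_space M 2 by (rule inf)
  have Xl: "(\<lambda>\<omega>. map (\<lambda>i. X i \<omega>) is) \<in> measurable M (count_space UNIV)"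
    if "set is \<subseteq> {1..n}" for "is"
    using that
  proof (induction "is")
    case (Cons i js)
    have "(\<lambda>\<omega>. (X i \<omega>, map (\<lambda>i. X i \<omega>) js)) \<in> measurable M (count_space UNIV \<Otimes>\<^sub>M count_space UNIV)"
      using Cons X by (intro measurable_Pair) auto
    hence "(\<lambda>\<omega>. (X i \<omega>, map (\<lambda>i. X i \<omega>) js)) \<in> measurable M (count_space UNIV)"
      by (simp add: pair_measure_countable)
    from measurable_compose[OF this, of "\<lambda>(x, xs). x # xs"] show ?case by simp
  qed simp
  have g: "g \<in> measurable M (count_space UNIV)"
    unfolding g_def
  proof (rule measurable_compose[OF Xl])
    show "set [1..<Suc n] \<subseteq> {1..n}" by auto
  qed simp
  interpret N: prob_space N unfolding N_def by (rule M.prob_space_distr[OF g])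
  interpret N: information_space N 2 by standard simp
  have Yg: "Y i (g \<omega>) = X i \<omega>" if "i \<in> {1..n}" for i \<omega>
    using that by (auto simp: Y_def g_def nth_map simp del: upt_Suc)
  have meas: "joint_var Y A \<in> measurable N (joint_alphabet A)" for A
    by (auto simp: N_def joint_var_def joint_alphabet_def)
  have comp: "joint_var Y A \<circ> g = joint_var X A" if "A \<subseteq> {1..n}" for A
    using that Yg by (auto simp: joint_var_def restrict_def fun_eq_iff)
  have D: "distr N (joint_alphabet A) (joint_var Y A) = distr M (joint_alphabet A) (joint_var X A)"
    if "A \<subseteq> {1..n}" for A
    unfolding N_def using meas[of A] comp[OF that] g
    by (subst distr_distr) (auto simp: N_def)
  have "has_entropy_function N Y n f"
    unfolding has_entropy_function_def
  proof (intro conjI allI impI)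
    show "information_space N 2" by (rule N.information_space_axioms)
    show "\<forall>i\<in>{1..n}. Y i \<in> measurable N (count_space UNIV)" by (simp add: N_def)
    fix A assume A: "A \<subseteq> {1..n}"
    from H[OF A] obtain p where p: "M.finite_entropy (joint_alphabet A) (joint_var X A) p" by blast
    have "N.finite_entropy (joint_alphabet A) (joint_var Y A) p"
      using p meas[of A] unfolding N.finite_entropy_def M.finite_entropy_def distributed_def D[OF A]
      by blast
    thus "\<exists>p. N.finite_entropy (joint_alphabet A) (joint_var Y A) p" by blast
    show "f A = N.entropy 2 (joint_alphabet A) (joint_var Y A)"
      using H[OF A] by (simp add: N.entropy_def M.entropy_def D[OF A])
  qed
  thus ?thesis unfolding entropic_def by blast
qed

end

theory Submission
  imports Defs
begin

text \<open>Reed--Solomon codes realise the function: choose a prime \<open>p\<close> with at least \<open>w([n])\<close> and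
  at least \<open>k\<close> residues, draw a uniformly random polynomial of degree less than \<open>k\<close> over the field
  with \<open>p\<close> elements, and let \<open>X\<^sub>i\<close> consist of its values at \<open>w\<^sub>i\<close> points, the points for different
  indices being distinct. Since any \<open>k\<close> values determine the polynomial, any \<open>m\<close> values are
  uniformly distributed on \<open>p^min(m,k)\<close> outcomes, so that \<open>H(X\<^sub>A) = min(w(A),k) log p\<close>.\<close>

text \<open>Lagrange's bound on the number of roots modulo \<open>p\<close>. Splitting off a root
  \<open>a\<close> gives q = (x - a) r + q(a) with q(a) divisible by \<open>p\<close>; at any other
  point of \<open>S\<close> the factor x - a is prime to \<open>p\<close>, so \<open>r\<close>
  vanishes there modulo \<open>p\<close> and has smaller degree. Working with divisibility by a
  prime element allows the integers as coefficients, in place of a residue field.\<close>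

lemma const_dvd_poly_if_many_roots:
  fixes q :: "'a::idom poly"
  assumes p: "prime_elem p" and S: "degree q < card S"
    and inj: "\<And>x y. x \<in> S \<Longrightarrow> y \<in> S \<Longrightarrow> p dvd x - y \<Longrightarrow> x = y"
    and root: "\<And>x. x \<in> S \<Longrightarrow> p dvd poly q x"
  shows "[:p:] dvd q"
  using S inj root
proof (induction "degree q" arbitrary: q S)
  case 0
  then obtain c where c: "q = [:c:]" by (metis degree_eq_zeroE)
  from 0 obtain x where "x \<in> S" by fastforce
  with 0(4)[of x] show ?case by (simp add: c const_poly_dvd_const_poly_iff)
next
  case (Suc d)
  from Suc.prems(1) have fin: "finite S" by (intro card_ge_0_finite) linarith
  from Suc.prems(1) obtain a where a: "a \<in> S" by fastforce
  define r where "r = synthetic_div q a"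
  have q: "q = [:- a, 1:] * r + [:poly q a:]"
    using synthetic_div_correct'[of a q] by (simp add: r_def)
  have deg: "d = degree r" using Suc.hyps(2) by (simp add: r_def degree_synthetic_div)
  have "[:p:] dvd r"
  proof (rule Suc.hyps(1)[OF deg])
    show "degree r < card (S - {a})" using Suc.prems(1) Suc.hyps(2) deg a fin by simp
    fix x assume x: "x \<in> S - {a}"
    have "poly q x = (x - a) * poly r x + poly q a"
      by (subst q) (simp add: algebra_simps)
    then have "p dvd (x - a) * poly r x"
      using Suc.prems(3)[of x] Suc.prems(3)[of a] a x by (metis DiffD1 dvd_add_left_iff)
    then show "p dvd poly r x"
      using Suc.prems(2)[of x a] a x p by (auto simp: prime_elem_dvd_mult_iff)
  qed (use Suc.prems in auto)
  moreover have "[:p:] dvd [:poly q a:]" using Suc.prems(3)[OF a] by (simp add: const_poly_dvd_const_poly_iff)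
  ultimately show ?case by (subst q) (meson dvd_add dvd_mult)
qed

text \<open>The Reed-Solomon symbol at \<open>x\<close> of the message \<open>c\<close>. Residues
  are coded as naturals, so every coefficient vector and every value below has to be confined to
  \<open>{..<p}\<close>.\<close>

definition rs_eval :: "nat \<Rightarrow> nat \<Rightarrow> (nat \<Rightarrow> nat) \<Rightarrow> nat \<Rightarrow> nat" where
  "rs_eval p k c x = (\<Sum>t<k. c t * x ^ t) mod p"

lemma rs_eval_eq_on_large_set:
  assumes p: "prime p" and S: "S \<subseteq> {..<p}" "k \<le> card S"
    and c: "c \<in> {..<k} \<rightarrow>\<^sub>E {..<p}" "c' \<in> {..<k} \<rightarrow>\<^sub>E {..<p}"
    and eq: "\<And>x. x \<in> S \<Longrightarrow> rs_eval p k c x = rs_eval p k c' x"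
  shows "c = c'"
proof (cases "k = 0")
  case True
  then show ?thesis using c by auto
next
  \<comment> \<open>The degree bound \<open>k - 1\<close> is strictly below \<open>k\<close> only
    for positive \<open>k\<close>.\<close>
  case False
  \<comment> \<open>The difference polynomial is formed over the integers, where subtraction does
    not truncate. It has at least \<open>k\<close> roots modulo \<open>p\<close>, so
    \<open>p\<close> divides all its coefficients, and coefficients below \<open>p\<close> that are
    congruent are equal.\<close>
  define q where "q = (\<Sum>t<k. monom (int (c t) - int (c' t)) t)"
  have q: "coeff q t = (if t < k then int (c t) - int (c' t) else 0)" for t
    by (simp add: q_def coeff_sum)
  have "degree q \<le> k - 1" by (rule degree_le) (auto simp: q)
  moreover have "card (int ` S) = card S" by (simp add: card_image)
  ultimately have deg: "degree q < card (int ` S)" using False S by linarith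
  have "[:int p:] dvd q"
  proof (rule const_dvd_poly_if_many_roots[OF _ deg])
    show "prime_elem (int p)" using p by simp
    fix x y assume xy: "x \<in> int ` S" "y \<in> int ` S" "int p dvd x - y"
    then obtain a b where ab: "x = int a" "y = int b" "a < p" "b < p" using S by auto
    with xy(3) have "int a mod int p = int b mod int p" by (intro iffD2[OF mod_eq_dvd_iff]) simp
    then have "a mod p = b mod p" by (metis of_nat_eq_iff zmod_int)
    with ab show "x = y" by simp
  next
    fix z assume "z \<in> int ` S"
    then obtain x where x: "x \<in> S" and z: "z = int x" by auto
    have "poly q z = int (\<Sum>t<k. c t * x ^ t) - int (\<Sum>t<k. c' t * x ^ t)"
      by (simp add: q_def z poly_sum poly_monom left_diff_distrib sum_subtractf)
    moreover have "int (\<Sum>t<k. c t * x ^ t) mod int p = int (\<Sum>t<k. c' t * x ^ t) mod int p"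
      using eq[OF x] unfolding rs_eval_def by (metis of_nat_mod)
    ultimately show "int p dvd poly q z" by (metis mod_eq_dvd_iff)
  qed
  then have dvd: "int p dvd coeff q t" for t by (simp add: const_poly_dvd_iff)
  have "c t = c' t" if t: "t < k" for t
  proof -
    have "int p dvd int (c t) - int (c' t)" using dvd[of t] q t by simp
    then have "int (c t) mod int p = int (c' t) mod int p" by (rule iffD2[OF mod_eq_dvd_iff])
    then have "c t mod p = c' t mod p" by (metis of_nat_eq_iff zmod_int)
    moreover have "c t < p" "c' t < p" using c t by auto
    ultimately show ?thesis by simp
  qed
  then show ?thesis using c by (intro PiE_ext[of c "{..<k}" _ c']) auto
qed

text \<open>Interpolation by counting: uniqueness gives injectivity, and both sides have p^k
  elements, so surjectivity follows without an explicit interpolation formula.\<close>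

lemma bij_betw_rs_eval:
  assumes p: "prime p" and T: "T \<subseteq> {..<p}" "card T = k"
  shows "bij_betw (\<lambda>c. restrict (rs_eval p k c) T) ({..<k} \<rightarrow>\<^sub>E {..<p}) (T \<rightarrow>\<^sub>E {..<p})"
proof -
  let ?R = "\<lambda>c. restrict (rs_eval p k c) T" and ?\<Omega> = "{..<k} \<rightarrow>\<^sub>E {..<p}"
  have finT: "finite T" using T by (meson finite_lessThan finite_subset)
  have inj: "inj_on ?R ?\<Omega>"
  proof (rule inj_onI)
    fix c c' assume c: "c \<in> ?\<Omega>" "c' \<in> ?\<Omega>" and eq: "?R c = ?R c'"
    have "rs_eval p k c x = rs_eval p k c' x" if "x \<in> T" for x
      using fun_cong[OF eq, of x] that by simp
    then show "c = c'" using rs_eval_eq_on_large_set[OF p T(1) _ c] T(2) by simp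
  qed
  moreover have "?R ` ?\<Omega> = T \<rightarrow>\<^sub>E {..<p}"
  proof (rule card_subset_eq)
    show "finite (T \<rightarrow>\<^sub>E {..<p})" using finT by (intro finite_PiE) auto
    have "rs_eval p k c x < p" for c x using prime_gt_0_nat[OF p] by (simp add: rs_eval_def)
    then show "?R ` ?\<Omega> \<subseteq> T \<rightarrow>\<^sub>E {..<p}" by auto
    show "card (?R ` ?\<Omega>) = card (T \<rightarrow>\<^sub>E {..<p})"
      unfolding card_image[OF inj] card_funcsetE[OF finT] card_funcsetE[OF finite_lessThan] T(2) by simp
  qed
  ultimately show ?thesis by (simp add: bij_betw_def)
qed

text \<open>The fibre size depends on \<open>card S\<close> alone, which makes the vector of values
  on \<open>S\<close> uniform on its range. With \<open>k\<close> or more points only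
  \<open>c\<close> itself remains. With fewer, \<open>S\<close> extends to \<open>k\<close>
  residues, and interpolation lets the values at the \<open>k - card S\<close> new points be chosen
  freely.\<close>

lemma card_rs_fibre:
  assumes p: "prime p" "k \<le> p" and S: "S \<subseteq> {..<p}" and c: "c \<in> {..<k} \<rightarrow>\<^sub>E {..<p}"
  shows "card {c' \<in> {..<k} \<rightarrow>\<^sub>E {..<p}. \<forall>x\<in>S. rs_eval p k c' x = rs_eval p k c x}
    = p ^ (k - min (card S) k)" (is "card ?F = _")
proof (cases "k \<le> card S")
  case True
  have "c' = c" if "c' \<in> ?F" for c'
    using that by (intro rs_eval_eq_on_large_set[OF p(1) S True _ c]) auto
  then have "?F = {c}" using c by auto
  then have "card ?F = 1" by (simp only: card.insert card.empty) simp
  then show ?thesis using True by simp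
next
  case False
  then obtain T where T: "S \<subseteq> T" "T \<subseteq> {..<p}" "card T = k"
    using exists_subset_between[of S k "{..<p}"] S p(2) by (metis card_lessThan finite_lessThan linear)
  have finT: "finite T" using T by (meson finite_lessThan finite_subset)
  let ?R = "\<lambda>c. restrict (rs_eval p k c) T" and ?\<Omega> = "{..<k} \<rightarrow>\<^sub>E {..<p}"
  \<comment> \<open>The value vectors on \<open>T\<close> that are prescribed on \<open>S\<close>
    and free elsewhere.\<close>
  let ?G = "\<Pi>\<^sub>E x\<in>T. if x \<in> S then {rs_eval p k c x} else {..<p}"
  note bij = bij_betw_rs_eval[OF p(1) T(2,3)]
  have lt: "rs_eval p k c x < p" for c x using prime_gt_0_nat[OF p(1)] by (simp add: rs_eval_def)
  have "?R ` ?F = ?G"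
  proof (intro subset_antisym subsetI)
    fix g assume "g \<in> ?R ` ?F"
    then show "g \<in> ?G" using lt by auto
  next
    fix g assume g: "g \<in> ?G"
    have "g \<in> T \<rightarrow>\<^sub>E {..<p}"
    proof (rule PiE_I)
      show "g x \<in> {..<p}" if "x \<in> T" for x
        using PiE_mem[OF g that] lt[of c x] by (auto split: if_splits)
      show "g x = undefined" if "x \<notin> T" for x using PiE_arb[OF g that] .
    qed
    then obtain c' where c': "c' \<in> ?\<Omega>" "g = ?R c'"
      using bij_betw_imp_surj_on[OF bij] by blast
    moreover have "rs_eval p k c' x = rs_eval p k c x" if "x \<in> S" for x
      using PiE_mem[OF g, of x] that T(1) c'(2) by auto
    ultimately show "g \<in> ?R ` ?F" by blast
  qed
  moreover have "inj_on ?R ?F" by (rule inj_on_subset[OF bij_betw_imp_inj_on[OF bij]]) auto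
  ultimately have "card ?F = card ?G" using card_image[of ?R ?F] by (simp only:)
  also have "\<dots> = (\<Prod>x\<in>T. card (if x \<in> S then {rs_eval p k c x} else {..<p}))"
    by (rule card_PiE[OF finT])
  also have "\<dots> = (\<Prod>x\<in>T. if x \<in> S then 1 else p)"
    by (rule prod.cong) simp_all
  also have "\<dots> = (\<Prod>x\<in>T - S. p)"
    by (rule prod.mono_neutral_cong_right[OF finT]) auto
  also have "\<dots> = p ^ card (T - S)" by simp
  also have "card (T - S) = k - min (card S) k"
    using T False finT finite_subset[OF T(1) finT] by (simp add: card_Diff_subset)
  finally show ?thesis .
qed

text \<open>Equal fibres make \<open>X\<close> uniform on its image, which has
  \<open>card \<Omega> / d\<close> points. The alphabet \<open>T\<close> is only assumed countable,
  because joint variables take values in an infinite function space.\<close>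

lemma entropy_equal_fibres:
  fixes X :: "'a \<Rightarrow> 'b" and \<Omega> :: "'a set"
  defines "M \<equiv> uniform_count_measure \<Omega>"
  assumes \<Omega>: "finite \<Omega>" "\<Omega> \<noteq> {}" and T: "countable T" "X ` \<Omega> \<subseteq> T"
    and fibre: "\<And>\<omega>. \<omega> \<in> \<Omega> \<Longrightarrow> card {\<omega>' \<in> \<Omega>. X \<omega>' = X \<omega>} = d"
  shows "\<exists>f. information_space.finite_entropy M 2 (count_space T) X f"
    and "prob_space.entropy M 2 (count_space T) X = log 2 (card \<Omega> / d)"
proof -
  interpret prob_space M unfolding M_def by (rule prob_space_uniform_count_measure[OF \<Omega>])
  interpret information_space M 2 by standard simp
  define f where "f y = card {\<omega> \<in> \<Omega>. X \<omega> = y} / card \<Omega>" for y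
  have f0: "f y = 0" if "y \<notin> X ` \<Omega>" for y
  proof -
    have "{\<omega> \<in> \<Omega>. X \<omega> = y} = {}" using that by auto
    then show ?thesis unfolding f_def by (simp only: card.empty)
  qed
  have f1: "f y = d / card \<Omega>" if "y \<in> X ` \<Omega>" for y using that fibre by (auto simp: f_def)
  have meas: "X \<in> measurable M (count_space T)"
    using T by (auto simp: M_def measurable_def space_uniform_count_measure sets_uniform_count_measure)
  have D: "distributed M (count_space T) X (\<lambda>y. ennreal (f y))"
    unfolding distributed_def
  proof (intro conjI)
    show "distr M (count_space T) X = density (count_space T) (\<lambda>y. ennreal (f y))"
    proof (rule measure_eqI_countable[of _ T])
      fix y assume y: "y \<in> T"
      have "X -` {y} \<inter> \<Omega> = {\<omega> \<in> \<Omega>. X \<omega> = y}" by auto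
      then have "emeasure (distr M (count_space T) X) {y} = ennreal (f y)"
        using y meas \<Omega> by (simp add: emeasure_distr M_def emeasure_uniform_count_measure
            space_uniform_count_measure f_def)
      also have "\<dots> = emeasure (density (count_space T) (\<lambda>y. ennreal (f y))) {y}"
        using y by (simp add: emeasure_density nn_integral_count_space_indicator[symmetric]
            nn_integral_indicator_singleton)
      finally show "emeasure (distr M (count_space T) X) {y}
        = emeasure (density (count_space T) (\<lambda>y. ennreal (f y))) {y}" .
    qed (use T in auto)
  qed (use meas in auto)
  have nn: "0 \<le> f y" for y by (simp add: f_def)
  \<comment> \<open>The mass function vanishes off the finite image. This yields integrability,
    hence finite entropy, and later turns the integral into a finite sum.\<close>
  have supp: "{y \<in> T. f y * log 2 (f y) \<noteq> 0} \<subseteq> X ` \<Omega>" using f0 by force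
  have fin: "finite {y \<in> T. f y * log 2 (f y) \<noteq> 0}"
    using supp \<Omega> by (meson finite_imageI finite_subset)
  have "integrable (count_space T) (\<lambda>y. f y * log 2 (f y))"
  proof (rule integrableI_bounded)
    have "{y \<in> T. 0 < ennreal (norm (f y * log 2 (f y)))} \<subseteq> {y \<in> T. f y * log 2 (f y) \<noteq> 0}"
      by auto
    then show "(\<integral>\<^sup>+y. ennreal (norm (f y * log 2 (f y))) \<partial>count_space T) < \<infinity>"
      using fin by (subst nn_integral_count_space) (auto intro: finite_subset)
  qed simp
  then have "finite_entropy (count_space T) X f" using D nn by (simp add: finite_entropy_def)
  then show "\<exists>f. finite_entropy (count_space T) X f" by blast
  \<comment> \<open>Counting \<Omega> by fibres shows that the equal probabilities
    \<open>d / card \<Omega>\<close> add up to 1, so the entropy sum collapses to one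
    logarithm.\<close>
  have "card \<Omega> = (\<Sum>y\<in>X ` \<Omega>. card {\<omega> \<in> \<Omega>. X \<omega> = y})"
    using sum.image_gen[OF \<Omega>(1), of "\<lambda>_. 1::nat" X] by simp
  also have "\<dots> = (\<Sum>y\<in>X ` \<Omega>. d)" by (intro sum.cong) (auto simp: fibre)
  also have "\<dots> = card (X ` \<Omega>) * d" by simp
  finally have card: "card \<Omega> = card (X ` \<Omega>) * d" .
  have pos: "card \<Omega> > 0" using \<Omega> by (simp add: card_gt_0_iff)
  have "entropy 2 (count_space T) X = - (\<integral>y. f y * log 2 (f y) \<partial>count_space T)"
    by (rule entropy_distr[OF D]) (rule nn)
  also have "(\<integral>y. f y * log 2 (f y) \<partial>count_space T) = (\<Sum>y\<in>X ` \<Omega>. f y * log 2 (f y))"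
    using supp T(2) \<Omega>(1) by (subst lebesgue_integral_count_space_finite_support[OF fin])
      (auto intro!: sum.mono_neutral_left)
  also have "\<dots> = (\<Sum>y\<in>X ` \<Omega>. d / card \<Omega> * log 2 (d / card \<Omega>))"
    by (intro sum.cong) (auto simp: f1)
  also have "\<dots> = log 2 (d / card \<Omega>)" using card pos by (simp add: field_simps)
  also have "- \<dots> = log 2 (card \<Omega> / d)"
    using card pos by (simp add: log_divide)
  finally show "entropy 2 (count_space T) X = log 2 (card \<Omega> / d)" .
qed

theorem corollary1:
  fixes n k :: nat and w :: "nat \<Rightarrow> nat"
  assumes "n \<ge> 1" and "k \<ge> 1"
  shows "entropic_up_to_constant_factor n (\<lambda>A. real (min (\<Sum>i\<in>A. w i) k))"
proof -
  \<comment> \<open>The bound leaves room in \<open>{..<p}\<close> for disjoint blocks of w_1, ...,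
    w_n evaluation points and also ensures \<open>k \<le> p\<close>.\<close>
  obtain p where p: "prime p" and p_gt: "p > (\<Sum>i=1..n. w i) + k"
    using bigger_prime by blast
  have p1: "p > 1" using p by (rule prime_gt_1_nat)
  \<comment> \<open>Partial sums of the weights, so that the blocks \<open>B i\<close> are
    consecutive intervals of length \<open>w i\<close>.\<close>
  define s where "s i = (\<Sum>j=1..<i. w j)" for i
  define B where "B i = {s i..<s i + w i}" for i
  have s_mono: "s i + w i \<le> s j" if "i \<ge> 1" "i < j" for i j
  proof -
    have "s i + w i = s (Suc i)" using that by (simp add: s_def)
    also have "\<dots> \<le> s j" unfolding s_def using that by (intro sum_mono2) auto
    finally show ?thesis .
  qed
  have B_disj: "B i \<inter> B j = {}" if "i \<ge> 1" "j \<ge> 1" "i \<noteq> j" for i j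
    using s_mono[of i j] s_mono[of j i] that unfolding B_def by (cases i j rule: linorder_cases) auto
  have B_sub: "B i \<subseteq> {..<p}" if "i \<in> {1..n}" for i
  proof -
    have "s i + w i \<le> s (Suc n)" using s_mono[of i "Suc n"] that by auto
    also have "\<dots> < p" using p_gt by (simp add: s_def atLeastLessThanSuc_atLeastAtMost)
    finally show ?thesis by (auto simp: B_def)
  qed
  define \<Omega> where "\<Omega> = {..<k} \<rightarrow>\<^sub>E {..<p}"
  have \<Omega>: "finite \<Omega>" "\<Omega> \<noteq> {}" "card \<Omega> = p ^ k"
    using p1 by (auto simp: \<Omega>_def card_funcsetE PiE_eq_empty_iff intro!: finite_PiE)
  \<comment> \<open>The variables must be nat-valued; the injective \<open>to_nat\<close> packs a
    block of values into one number without losing information.\<close>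
  define X where "X i c = to_nat (map (rs_eval p k c) [s i..<s i + w i])" for i c
  have X_eq: "X i c = X i c' \<longleftrightarrow> (\<forall>x\<in>B i. rs_eval p k c x = rs_eval p k c' x)" for i c c'
    by (auto simp: X_def B_def)
  define M where "M = uniform_count_measure \<Omega>"
  \<comment> \<open>Entropy is measured in bits and a uniform residue carries \<open>log 2 p\<close>
    of them; this is the constant factor.\<close>
  have "has_entropy_function M X n (\<lambda>A. log 2 p * real (min (\<Sum>i\<in>A. w i) k))"
    unfolding has_entropy_function_def
  proof (intro conjI allI impI ballI)
    interpret prob_space M unfolding M_def by (rule prob_space_uniform_count_measure[OF \<Omega>(1,2)])
    show "information_space M 2" by standard simp
    show "X i \<in> measurable M (count_space UNIV)" for i
      by (auto simp: M_def measurable_def space_uniform_count_measure sets_uniform_count_measure)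
    fix A assume A: "A \<subseteq> {1..n}"
    have finA: "finite A" using A finite_subset by blast
    define S where "S = (\<Union>i\<in>A. B i)"
    have S: "S \<subseteq> {..<p}" unfolding S_def by (intro UN_least B_sub) (use A in blast)
    have "B i \<inter> B j = {}" if "i \<in> A" "j \<in> A" "i \<noteq> j" for i j
      using A that by (intro B_disj) auto
    then have "card S = (\<Sum>i\<in>A. card (B i))"
      unfolding S_def using finA by (intro card_UN_disjoint) (auto simp: B_def)
    then have cardS: "card S = (\<Sum>i\<in>A. w i)" by (simp add: B_def)
    let ?m = "min (\<Sum>i\<in>A. w i) k"
    have T: "countable (A \<rightarrow>\<^sub>E (UNIV :: nat set))" using finA by (intro countable_PiE) auto
    have XT: "joint_var X A ` \<Omega> \<subseteq> A \<rightarrow>\<^sub>E UNIV" by (auto simp: joint_var_def)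
    \<comment> \<open>The fibres of the joint variable are those of evaluation on the union of the
      blocks, whose size is the weight of \<open>A\<close>.\<close>
    have eq: "joint_var X A c' = joint_var X A c \<longleftrightarrow> (\<forall>x\<in>S. rs_eval p k c' x = rs_eval p k c x)" for c c'
    proof -
      have "joint_var X A c' = joint_var X A c \<longleftrightarrow> (\<forall>i\<in>A. X i c' = X i c)"
        by (auto simp: joint_var_def restrict_def fun_eq_iff)
      then show ?thesis by (auto simp: X_eq S_def)
    qed
    have fibre: "card {c' \<in> \<Omega>. joint_var X A c' = joint_var X A c} = p ^ (k - ?m)" if "c \<in> \<Omega>" for c
      using card_rs_fibre[OF p _ S, of k c] p_gt that by (simp add: eq cardS \<Omega>_def)
    note E = entropy_equal_fibres[OF \<Omega>(1,2) T XT fibre, folded M_def joint_alphabet_def]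
    show "\<exists>f. information_space.finite_entropy M 2 (joint_alphabet A) (joint_var X A) f"
      by (rule E(1))
    have "real p ^ k = real p ^ (k - ?m) * real p ^ ?m" by (simp flip: power_add)
    then have "real (card \<Omega>) / real (p ^ (k - ?m)) = real p ^ ?m"
      using p1 by (simp add: \<Omega>(3))
    then show "log 2 p * real ?m = entropy 2 (joint_alphabet A) (joint_var X A)"
      using E(2) p1 by (simp add: log_nat_power)
  qed
  \<comment> \<open>The sample space here consists of coefficient vectors;
    \<open>has_entropy_function_imp_entropic\<close> moves the result to a sample space of
    naturals.\<close>
  moreover have "log 2 p > 0" using p1 by simp
  ultimately show ?thesis
    unfolding entropic_up_to_constant_factor_def using has_entropy_function_imp_entropic by blast
qed

end
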